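(* Let $\frac12<t<1$ and let $G$ be a series–parallel graph with $\tau(G)=t$. Then $G$ is minimally $t$-tough if and only if $G$ has no jump-edges.
   Context: All graphs are finite and undirected; parallel edges are allowed. For a graph $H$, $c(H)$ denotes its number of components. A set $S\subseteq V(G)$ is a cutset if $c(G-S)>1$. $G$ is $t$-tough if $|S|\ge t\cdot c(G-S)$ for every cutset $S$; the toughness $\tau(G)$ is the largest such $t$, with $\tau(K_n)=\infty$. $G$ is minimally $t$-tough if $\tau(G)=t$ and $\tau(G-e)<t$ for every edge $e$. A series–parallel graph $G(s,t)$ with terminals $s,t$ is either a single edge $st$, or is obtained from series–parallel graphs $G_1(s_1,t_1),\dots,G_k(s_k,t_k)$, $k\ge 2$, by a series join (identify $t_i$ with $s_{i+1}$ for $1\le i\le k-1$, set $s=s_1$, $t=t_k$) or a parallel join (identify all $s_i$ into $s$ and all $t_i$ into $t$). The construction gives a rooted ordered tree $T_G$ (the sp-tree): leaves correspond to edges of $G$, internal nodes to series or parallel joins (children ordered as joined). The joins are chosen so that the parent of a series node is always a parallel node and the parent of a parallel node is always a series node. An edge $e$ is a leap-edge if its parent in $T_G$ is a parallel node which is the root of $T_G$ and $e$ has exactly one sibling, which is a series node. An edge $e$ is a jump-edge if its parent in $T_G$ is a parallel node and $e$ is not a leap-edge, i.e. either the parent is not the root, or the parent is the root and $e$ has at least two series-node siblings. *)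

theory Defs
  imports Complex_Main "HOL-Library.Extended_Real"
begin

record ('v, 'e) mgraph =
  verts :: "'v set"
  edges :: "'e set"
  ends :: "'e \<Rightarrow> 'v set"

text \<open>Edges are named objects, so distinct edges may have the same pair of endpoints.
  The value of \<open>ends\<close> outside the edge set is irrelevant.\<close>

locale multigraph =
  fixes G :: "('v, 'e) mgraph"
  assumes finite_verts: "finite (verts G)"
    and finite_edges: "finite (edges G)"
    and ends_subset: "e \<in> edges G \<Longrightarrow> ends G e \<subseteq> verts G"
    and card_ends: "e \<in> edges G \<Longrightarrow> card (ends G e) = 2"

definition del_verts :: "('v, 'e) mgraph \<Rightarrow> 'v set \<Rightarrow> ('v, 'e) mgraph" where
  "del_verts G S = \<lparr>verts = verts G - S, edges = {e \<in> edges G. ends G e \<inter> S = {}}, ends = ends G\<rparr>"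

definition del_edge :: "('v, 'e) mgraph \<Rightarrow> 'e \<Rightarrow> ('v, 'e) mgraph" where
  "del_edge G e = \<lparr>verts = verts G, edges = edges G - {e}, ends = ends G\<rparr>"

definition adj_rel :: "('v, 'e) mgraph \<Rightarrow> ('v \<times> 'v) set" where
  "adj_rel G = {(u, v). \<exists>e \<in> edges G. ends G e = {u, v}}"

definition connected_rel :: "('v, 'e) mgraph \<Rightarrow> ('v \<times> 'v) set" where
  "connected_rel G = {(u, v). u \<in> verts G \<and> v \<in> verts G \<and> (u, v) \<in> (adj_rel G)\<^sup>*}"

definition num_components :: "('v, 'e) mgraph \<Rightarrow> nat" where
  "num_components G = card (verts G // connected_rel G)"

definition cutset :: "('v, 'e) mgraph \<Rightarrow> 'v set \<Rightarrow> bool" where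
  "cutset G S \<longleftrightarrow> S \<subseteq> verts G \<and> num_components (del_verts G S) > 1"

definition tough :: "real \<Rightarrow> ('v, 'e) mgraph \<Rightarrow> bool" where
  "tough t G \<longleftrightarrow> (\<forall>S. cutset G S \<longrightarrow> real (card S) \<ge> t * real (num_components (del_verts G S)))"

text \<open>If a finite graph has a cutset, then the supremum is attained. If there is none, that is, if
  any two distinct vertices are adjacent, then every real \<open>t\<close> qualifies and the value is \<open>\<infinity>\<close>.\<close>

definition toughness :: "('v, 'e) mgraph \<Rightarrow> ereal" where
  "toughness G = Sup {ereal t |t. tough t G}"

definition minimally_tough :: "real \<Rightarrow> ('v, 'e) mgraph \<Rightarrow> bool" where
  "minimally_tough t G \<longleftrightarrow>
     toughness G = ereal t \<and> (\<forall>e \<in> edges G. toughness (del_edge G e) < ereal t)"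

datatype 'e sptree =
    is_Leaf: Leaf 'e
  | is_Series: Series "'e sptree list"
  | is_Parallel: Parallel "'e sptree list"

text \<open>\<open>is_union G Gs\<close>: the edge-disjoint graphs \<open>Gs\<close> are subgraphs of \<open>G\<close> whose union is \<open>G\<close>.
  The identification of terminals in a join is expressed by the parts literally sharing those
  vertices, and no others.\<close>

definition is_union :: "('v, 'e) mgraph \<Rightarrow> ('v, 'e) mgraph list \<Rightarrow> bool" where
  "is_union G Gs \<longleftrightarrow>
     verts G = (\<Union>H \<in> set Gs. verts H) \<and>
     edges G = (\<Union>H \<in> set Gs. edges H) \<and>
     (\<forall>H \<in> set Gs. \<forall>e \<in> edges H. ends G e = ends H e) \<and>
     (\<forall>j < length Gs. \<forall>i < j. edges (Gs ! i) \<inter> edges (Gs ! j) = {})"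

text \<open>\<open>sp_construction G s t T\<close>: the graph \<open>G\<close> with terminals \<open>s\<close>, \<open>t\<close> is obtained by the
  construction recorded in \<open>T\<close>. In a series join, \<open>xs\<close> lists the terminals along the join, so that
  the \<open>i\<close>-th part has terminals \<open>xs ! i\<close> and \<open>xs ! Suc i\<close>.\<close>

inductive sp_construction :: "('v, 'e) mgraph \<Rightarrow> 'v \<Rightarrow> 'v \<Rightarrow> 'e sptree \<Rightarrow> bool" where
  edge: "\<lbrakk>s \<noteq> t; verts G = {s, t}; edges G = {e}; ends G e = {s, t}\<rbrakk>
     \<Longrightarrow> sp_construction G s t (Leaf e)"
| series: "\<lbrakk>k \<ge> 2; length Gs = k; length Ts = k; length xs = Suc k;
      \<forall>i < k. sp_construction (Gs ! i) (xs ! i) (xs ! Suc i) (Ts ! i);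
      \<forall>j < k. \<forall>i < j. verts (Gs ! i) \<inter> verts (Gs ! j) = (if j = Suc i then {xs ! j} else {});
      is_union G Gs; s = xs ! 0; t = xs ! k\<rbrakk>
     \<Longrightarrow> sp_construction G s t (Series Ts)"
| parallel: "\<lbrakk>k \<ge> 2; length Gs = k; length Ts = k;
      \<forall>i < k. sp_construction (Gs ! i) s t (Ts ! i);
      \<forall>j < k. \<forall>i < j. verts (Gs ! i) \<inter> verts (Gs ! j) = {s, t};
      is_union G Gs\<rbrakk>
     \<Longrightarrow> sp_construction G s t (Parallel Ts)"

definition series_parallel :: "('v, 'e) mgraph \<Rightarrow> 'v \<Rightarrow> 'v \<Rightarrow> bool" where
  "series_parallel G s t \<longleftrightarrow> (\<exists>T. sp_construction G s t T)"

text \<open>The nodes of a tree, each represented by the subtree rooted there. In the tree of a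
  construction this is faithful, since distinct leaves carry distinct edges.\<close>

primrec nodes :: "'e sptree \<Rightarrow> 'e sptree set" where
  "nodes (Leaf e) = {Leaf e}"
| "nodes (Series Ts) = insert (Series Ts) (\<Union>(set (map nodes Ts)))"
| "nodes (Parallel Ts) = insert (Parallel Ts) (\<Union>(set (map nodes Ts)))"

definition alternating :: "'e sptree \<Rightarrow> bool" where
  "alternating T \<longleftrightarrow>
     (\<forall>Ts. Series Ts \<in> nodes T \<longrightarrow> (\<forall>U \<in> set Ts. \<not> is_Series U)) \<and>
     (\<forall>Ts. Parallel Ts \<in> nodes T \<longrightarrow> (\<forall>U \<in> set Ts. \<not> is_Parallel U))"

text \<open>The sp-tree of \<open>G\<close> with terminals \<open>s\<close>, \<open>t\<close> is unique up to the order of the children of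
  parallel nodes.\<close>

definition sp_tree :: "('v, 'e) mgraph \<Rightarrow> 'v \<Rightarrow> 'v \<Rightarrow> 'e sptree \<Rightarrow> bool" where
  "sp_tree G s t T \<longleftrightarrow> sp_construction G s t T \<and> alternating T"

definition leap_edge :: "'e sptree \<Rightarrow> 'e \<Rightarrow> bool" where
  "leap_edge T e \<longleftrightarrow>
     (\<exists>Ts. T = Parallel [Leaf e, Series Ts] \<or> T = Parallel [Series Ts, Leaf e])"

definition jump_edge :: "'e sptree \<Rightarrow> 'e \<Rightarrow> bool" where
  "jump_edge T e \<longleftrightarrow> (\<exists>Ts. Parallel Ts \<in> nodes T \<and> Leaf e \<in> set Ts) \<and> \<not> leap_edge T e"

end

theory Submission
  imports Defs
begin

text \<open>If \<open>e\<close> is a leap-edge, or a child of a series node, then \<open>G - e\<close> is disconnected or has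
  a cut vertex, so its toughness is at most \<open>1/2\<close>. If \<open>e\<close> is a jump-edge with ends \<open>u\<close>, \<open>v\<close>, then
  \<open>G - e\<close> is the union of two edge sets \<open>F\<^sub>1\<close>, \<open>F\<^sub>2\<close> that share no vertices besides \<open>u\<close>, \<open>v\<close> and
  each contain a \<open>u\<close>-\<open>v\<close> path. A set \<open>S\<close> that separates \<open>u\<close> from \<open>v\<close> in \<open>G - e\<close> splits into
  nonempty sets \<open>S\<^sub>1\<close>, \<open>S\<^sub>2\<close> on the two sides, and \<open>c(G - e - S) \<le> c(G - S\<^sub>1) + c(G - S\<^sub>2)\<close>. Since
  \<open>\<bar>S\<^sub>i\<bar> \<ge> t c(G - S\<^sub>i)\<close>, where \<open>t \<le> 1 \<le> \<bar>S\<^sub>i\<bar>\<close> covers the case that \<open>S\<^sub>i\<close> is not a cutset of \<open>G\<close>,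
  the set \<open>S\<close> does not violate the toughness of \<open>G - e\<close>.\<close>

section \<open>Components and toughness\<close>

text \<open>Takes an incidence map and an edge set instead of a graph, so that walks inside
  arbitrary sets of edges, and walks in a part and in the whole, can be compared.\<close>

definition linked :: "('e \<Rightarrow> 'v set) \<Rightarrow> 'e set \<Rightarrow> 'v \<Rightarrow> 'v \<Rightarrow> bool" where
  "linked g F x y \<longleftrightarrow> (x, y) \<in> {(x, y). \<exists>f\<in>F. g f = {x, y}}\<^sup>*"

lemma linked_refl [simp]: "linked g F x x"
  by (simp add: linked_def)

lemma linked_edge: "f \<in> F \<Longrightarrow> g f = {x, y} \<Longrightarrow> linked g F x y"
  by (auto simp: linked_def)

lemma linked_trans: "linked g F x y \<Longrightarrow> linked g F y z \<Longrightarrow> linked g F x z"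
  unfolding linked_def by (rule rtrancl_trans)

lemma linked_sym: "linked g F x y \<Longrightarrow> linked g F y x"
  unfolding linked_def
  by (rule symD[OF sym_rtrancl]) (auto simp: sym_def insert_commute)

text \<open>The incidence map may change as well: each part of a join carries its own
  \<open>ends\<close>, tied to that of the whole on the edges of the part.\<close>

lemma linked_mono:
  assumes "linked g F x y" "F \<subseteq> F'" "\<And>f. f \<in> F \<Longrightarrow> g' f = g f"
  shows "linked g' F' x y"
  using assms(1) unfolding linked_def
  by (rule rtrancl_mono[THEN subsetD, rotated]) (use assms in force)

lemma adj_rel_rtrancl: "(x, y) \<in> (adj_rel G)\<^sup>* \<longleftrightarrow> linked (ends G) (edges G) x y"
  by (simp add: adj_rel_def linked_def)

section \<open>Components as classes of reachability\<close>

abbreviation components :: "('v, 'e) mgraph \<Rightarrow> 'v set set" where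
  "components G \<equiv> verts G // connected_rel G"

lemma equiv_connected_rel: "equiv (verts G) (connected_rel G)"
proof (rule equivI)
  show "connected_rel G \<subseteq> verts G \<times> verts G" "refl_on (verts G) (connected_rel G)"
    by (auto simp: refl_on_def connected_rel_def)
  show "sym (connected_rel G)"
    by (rule symI) (simp add: connected_rel_def adj_rel_rtrancl linked_sym)
  show "trans (connected_rel G)"
    by (rule transI) (auto simp: connected_rel_def)
qed

lemma finite_components: "finite (verts G) \<Longrightarrow> finite (components G)"
  by (rule finite_quotient) (auto simp: connected_rel_def)

lemma component_in: "x \<in> verts G \<Longrightarrow> connected_rel G `` {x} \<in> components G"
  by (rule quotientI)

text \<open>A walk of \<open>A\<close> starting in \<open>K\<close> never leaves \<open>K\<close>,
  where both graphs have the same adjacencies, so it is a walk of \<open>B\<close>, and conversely.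
  This will identify components of \<open>G - e - S\<close> with components left by one side of
  \<open>S\<close> in \<open>G\<close>.\<close>

lemma component_transfer:
  assumes K: "K \<in> components A"
    and A: "\<And>f. f \<in> edges A \<Longrightarrow> ends A f \<subseteq> verts A"
    and B: "K \<subseteq> verts B"
    and adj: "\<And>x y. x \<in> K \<Longrightarrow> (x, y) \<in> adj_rel A \<longleftrightarrow> (x, y) \<in> adj_rel B"
  shows "K \<in> components B"
proof -
  obtain x where x: "x \<in> verts A" "K = connected_rel A `` {x}"
    using K by (auto elim: quotientE)
  have xK: "x \<in> K"
    using x by (auto simp: connected_rel_def)
  have K_eq: "y \<in> K \<longleftrightarrow> y \<in> verts A \<and> (x, y) \<in> (adj_rel A)\<^sup>*" for y
    using x by (simp add: connected_rel_def)
  have closed: "z \<in> K" if "y \<in> K" "(y, z) \<in> adj_rel A" for y z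
  proof -
    have "z \<in> verts A"
      using A that(2) by (auto simp: adj_rel_def)
    then show ?thesis
      using that by (auto simp: K_eq intro: rtrancl_into_rtrancl)
  qed
  have reach_B: "y \<in> K" if "(x, y) \<in> (adj_rel B)\<^sup>*" for y
    using that
  proof induction
    case (step y z)
    then show ?case
      using adj[of y z] closed by simp
  qed (rule xK)
  have "(x, y) \<in> (adj_rel A)\<^sup>* \<Longrightarrow> y \<in> K \<and> (x, y) \<in> (adj_rel B)\<^sup>*" for y
  proof (induction rule: rtrancl_induct)
    case (step y z)
    then have "(y, z) \<in> adj_rel B" "z \<in> K"
      using adj[of y z] closed[of y z] by simp_all
    with step show ?case
      by (meson rtrancl.rtrancl_into_rtrancl)
  qed (simp add: xK)
  then have "y \<in> K \<longleftrightarrow> (x, y) \<in> (adj_rel B)\<^sup>*" for y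
    using reach_B[of y] K_eq[of y] by blast
  then have "K = connected_rel B `` {x}"
    using xK B by (auto simp: connected_rel_def)
  then show ?thesis
    using component_in[of x B] xK B by auto
qed

section \<open>Bounds on toughness\<close>

lemma toughness_ge: "tough t G \<Longrightarrow> ereal t \<le> toughness G"
  unfolding toughness_def by (rule Sup_upper) auto

text \<open>With \<open>c\<close> components left by \<open>S\<close>, every admissible
  \<open>t\<close> satisfies \<open>t * c \<le> card S \<le> r * c\<close>, and the positive
  \<open>c\<close> cancels.\<close>

lemma toughness_le:
  fixes r :: real
  assumes "cutset G S" and "card S \<le> r * num_components (del_verts G S)"
  shows "toughness G \<le> ereal r"
  unfolding toughness_def
proof (rule Sup_least)
  fix x assume "x \<in> {ereal t |t. tough t G}"
  then obtain t where t: "x = ereal t" "tough t G"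
    by auto
  then have "t * num_components (del_verts G S) \<le> r * num_components (del_verts G S)"
    using assms by (fastforce simp: tough_def)
  then show "x \<le> ereal r"
    using assms(1) t by (auto simp: cutset_def)
qed

text \<open>The supremum is attained: each cutset caps the toughness at its own ratio, which is the
  very inequality it imposes on \<open>t\<close>.\<close>

lemma tough_toughness:
  assumes "toughness G = ereal t"
  shows "tough t G"
  unfolding tough_def
proof (intro allI impI)
  fix S assume S: "cutset G S"
  let ?c = "real (num_components (del_verts G S))"
  have c: "?c > 0"
    using S by (auto simp: cutset_def)
  then have "toughness G \<le> ereal (card S / ?c)"
    by (intro toughness_le[OF S]) simp
  then show "t * ?c \<le> card S"
    using assms c by (simp add: field_simps)
qed

text \<open>No edge leaves \<open>A\<close> once \<open>S\<close> is gone, so \<open>y\<close> and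
  \<open>z\<close> lie in different components, and at most one vertex produces at least two of
  them. Empty \<open>S\<close> covers disconnected graphs, a singleton covers cut vertices.\<close>

lemma toughness_le_half:
  assumes fin: "finite (verts G)"
    and S: "S \<subseteq> verts G" "card S \<le> 1"
    and y: "y \<in> verts G - S" "y \<in> A"
    and z: "z \<in> verts G - S" "z \<notin> A"
    and A: "\<And>f. f \<in> edges G \<Longrightarrow> ends G f \<inter> A = {} \<or> ends G f \<subseteq> A \<union> S"
  shows "toughness G \<le> ereal (1/2)"
proof -
  let ?H = "del_verts G S"
  have "x \<in> A" if "(y, x) \<in> (adj_rel ?H)\<^sup>*" for x
    using that
  proof induction
    case (step x x')
    then obtain f where f: "f \<in> edges G" "ends G f = {x, x'}" "ends G f \<inter> S = {}"
      by (auto simp: adj_rel_def del_verts_def)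
    then show ?case
      using A[of f] step by auto
  qed (use y in auto)
  then have "(y, z) \<notin> connected_rel ?H"
    using z by (auto simp: connected_rel_def)
  moreover have yz: "y \<in> verts ?H" "z \<in> verts ?H"
    using y z by (auto simp: del_verts_def)
  ultimately have ne: "connected_rel ?H `` {y} \<noteq> connected_rel ?H `` {z}"
    using eq_equiv_class_iff[OF equiv_connected_rel[of ?H]] by blast
  have "finite (verts ?H)"
    using fin by (simp add: del_verts_def)
  then have "card {connected_rel ?H `` {y}, connected_rel ?H `` {z}} \<le> num_components ?H"
    unfolding num_components_def using yz
    by (intro card_mono finite_components) (auto intro: component_in)
  then have "num_components ?H \<ge> 2"
    using ne by simp
  then show ?thesis
    using S by (intro toughness_le[of G S]) (auto simp: cutset_def)
qed

text \<open>Either \<open>S\<close> destroys \<open>e\<close> anyway, or a walk avoiding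
  \<open>e\<close> replaces it; in both cases reachability stays the same.\<close>

lemma num_components_del_edge:
  assumes e: "e \<in> edges G" "ends G e = {u, v}"
    and S: "u \<in> S \<or> v \<in> S \<or> (u, v) \<in> (adj_rel (del_verts (del_edge G e) S))\<^sup>*"
  shows "num_components (del_verts (del_edge G e) S) = num_components (del_verts G S)"
proof -
  let ?A = "del_verts (del_edge G e) S" and ?B = "del_verts G S"
  have "adj_rel ?A \<subseteq> adj_rel ?B"
    by (auto simp: adj_rel_def del_verts_def del_edge_def)
  moreover have "adj_rel ?B \<subseteq> (adj_rel ?A)\<^sup>*"
  proof (clarify)
    fix x y assume "(x, y) \<in> adj_rel ?B"
    then obtain f where f: "f \<in> edges G" "ends G f = {x, y}" "ends G f \<inter> S = {}"
      by (auto simp: adj_rel_def del_verts_def)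
    show "(x, y) \<in> (adj_rel ?A)\<^sup>*"
    proof (cases "f = e")
      case True
      then have "(u, v) \<in> (adj_rel ?A)\<^sup>*" "x = u \<and> y = v \<or> x = v \<and> y = u"
        using f e S by (auto simp: doubleton_eq_iff)
      then show ?thesis
        by (auto simp: adj_rel_rtrancl intro: linked_sym)
    next
      case False
      then show ?thesis
        using f by (intro r_into_rtrancl) (auto simp: adj_rel_def del_verts_def del_edge_def)
    qed
  qed
  ultimately have "(adj_rel ?A)\<^sup>* = (adj_rel ?B)\<^sup>*"
    by (rule rtrancl_subset[symmetric])
  then show ?thesis
    by (simp add: num_components_def connected_rel_def del_verts_def del_edge_def)
qed

section \<open>Deleting an edge bypassed on two sides\<close>

text \<open>Every edge of \<open>G\<close> at \<open>K\<close> belongs to \<open>F\<close>, since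
  \<open>K\<close> misses the edges of \<open>F'\<close> and both ends of \<open>e\<close>.
  Restoring \<open>e\<close> and the vertices of \<open>S\<close> off \<open>F\<close> therefore
  changes no adjacency at \<open>K\<close>.\<close>

lemma num_components_side:
  assumes G: "multigraph G"
    and e: "ends G e = {u, v}"
    and F: "F \<union> F' = edges G - {e}"
    and K: "K \<in> components (del_verts (del_edge G e) S)" "u \<notin> K" "v \<notin> K"
    and off: "K \<inter> \<Union>(ends G ` F') = {}"
  shows "K \<in> components (del_verts G (S \<inter> \<Union>(ends G ` F)))"
proof (rule component_transfer[OF K(1)])
  interpret multigraph G by fact
  let ?A = "del_verts (del_edge G e) S"
  let ?B = "del_verts G (S \<inter> \<Union>(ends G ` F))"
  show "ends ?A f \<subseteq> verts ?A" if "f \<in> edges ?A" for f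
    using that ends_subset by (auto simp: del_verts_def del_edge_def)
  show "K \<subseteq> verts ?B"
    using K(1) by (auto simp: del_verts_def del_edge_def connected_rel_def elim!: quotientE)
  fix x y assume x: "x \<in> K"
  show "(x, y) \<in> adj_rel ?A \<longleftrightarrow> (x, y) \<in> adj_rel ?B"
  proof
    assume "(x, y) \<in> adj_rel ?B"
    then obtain f where f: "f \<in> edges G" "ends G f = {x, y}"
        "ends G f \<inter> (S \<inter> \<Union>(ends G ` F)) = {}"
      by (auto simp: adj_rel_def del_verts_def)
    have "f \<noteq> e"
      using f(2) e x K(2,3) by (auto simp: doubleton_eq_iff)
    moreover have "f \<notin> F'"
      using f(2) x off by auto
    ultimately have "f \<in> F"
      using f(1) F by blast
    then have "ends G f \<inter> S = {}"
      using f(3) by blast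
    then show "(x, y) \<in> adj_rel ?A"
      using f \<open>f \<noteq> e\<close> by (auto simp: adj_rel_def del_verts_def del_edge_def)
  qed (fastforce simp: adj_rel_def del_verts_def del_edge_def)
qed

text \<open>A set separating \<open>u\<close> from \<open>v\<close> in \<open>G - e\<close> has to
  block the walks on both sides and pays for each; any other cutset leaves as many components as it
  does in \<open>G\<close>.\<close>

lemma tough_del_edge:
  assumes G: "multigraph G" and t: "0 \<le> t" "t \<le> 1" "tough t G"
    and e: "e \<in> edges G" "ends G e = {u, v}"
    and F: "F1 \<union> F2 = edges G - {e}"
    and meet: "\<Union>(ends G ` F1) \<inter> \<Union>(ends G ` F2) \<subseteq> {u, v}"
    and links: "linked (ends G) F1 u v" "linked (ends G) F2 u v"
  shows "tough t (del_edge G e)"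
  unfolding tough_def
proof (intro allI impI)
  interpret multigraph G by fact
  fix S assume S: "cutset (del_edge G e) S"
  let ?A = "del_verts (del_edge G e) S"
  have SV: "S \<subseteq> verts G"
    using S by (simp add: cutset_def del_edge_def)
  then have finS: "finite S"
    using finite_verts finite_subset by blast
  show "t * num_components ?A \<le> card S"
  proof (cases "u \<in> S \<or> v \<in> S \<or> (u, v) \<in> (adj_rel ?A)\<^sup>*")
    case True
    then have "num_components ?A = num_components (del_verts G S)"
      by (rule num_components_del_edge[OF e])
    then show ?thesis
      using S SV t by (auto simp: tough_def cutset_def)
  next
    case False
    define S1 where "S1 = S \<inter> \<Union>(ends G ` F1)"
    define S2 where "S2 = S \<inter> \<Union>(ends G ` F2)"
    have uvV: "u \<in> verts G" "v \<in> verts G"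
      using ends_subset[OF e(1)] e(2) by auto
    \<comment> \<open>A walk in \<open>F\<close> untouched by \<open>S\<close> would survive in
      \<open>?A\<close> and link \<open>u\<close> to \<open>v\<close>.\<close>
    have nonempty: "S \<inter> \<Union>(ends G ` F) \<noteq> {}"
      if "linked (ends G) F u v" "F \<subseteq> edges G - {e}" for F
    proof
      assume "S \<inter> \<Union>(ends G ` F) = {}"
      then have "linked (ends ?A) (edges ?A) u v"
        using that by (intro linked_mono[OF that(1)]) (auto simp: del_verts_def del_edge_def)
      then show False
        using False by (simp add: adj_rel_rtrancl)
    qed
    have bound: "t * num_components (del_verts G S') \<le> card S'" if "S' \<subseteq> S" "S' \<noteq> {}" for S'
    proof (cases "num_components (del_verts G S') > 1")
      case True
      then show ?thesis
        using that SV t by (auto simp: tough_def cutset_def)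
    next
      case False
      have "card S' \<ge> 1"
        using that finS by (simp add: Suc_leI card_gt_0_iff finite_subset)
      moreover have "t * num_components (del_verts G S') \<le> 1 * 1"
        using False t by (intro mult_mono) auto
      ultimately show ?thesis
        by linarith
    qed
    let ?B1 = "del_verts G S1" and ?B2 = "del_verts G S2"
    let ?K = "\<lambda>H x. connected_rel H `` {x}"
    have u_verts: "u \<in> verts ?B1" "u \<in> verts ?B2"
      using False uvV by (auto simp: del_verts_def S1_def S2_def)
    have fin: "finite (components ?B1)" "finite (components ?B2)"
      by (rule finite_components, simp add: del_verts_def finite_verts)+
    \<comment> \<open>A component with neither \<open>u\<close> nor \<open>v\<close> survives in
      \<open>?B1\<close> or \<open>?B2\<close>, and is not the component of \<open>u\<close> there.
      Leaving out the latter on each side compensates for the classes of \<open>u\<close> and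
      \<open>v\<close> in \<open>?A\<close>.\<close>
    have "components ?A \<subseteq> {?K ?A u, ?K ?A v} \<union> (components ?B1 - {?K ?B1 u})
        \<union> (components ?B2 - {?K ?B2 u})"
    proof
      fix K assume K: "K \<in> components ?A"
      have cls: "K = ?K ?A x" if x: "x \<in> K" for x
      proof -
        have "x \<in> verts ?A"
          using in_quotient_imp_subset[OF equiv_connected_rel K] x by blast
        then show ?thesis
          using quotient_eq_iff[OF equiv_connected_rel K component_in x] equiv_connected_rel
          by (metis equiv_class_self equivE refl_onD)
      qed
      have reach: "y \<in> K \<longleftrightarrow> y \<in> verts ?A \<and> (x, y) \<in> (adj_rel ?A)\<^sup>*" if "x \<in> K" for x y
        using in_quotient_imp_subset[OF equiv_connected_rel K] that
        by (subst cls[OF that]) (auto simp: connected_rel_def)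
      show "K \<in> {?K ?A u, ?K ?A v} \<union> (components ?B1 - {?K ?B1 u})
        \<union> (components ?B2 - {?K ?B2 u})"
      proof (cases "u \<in> K \<or> v \<in> K")
        case True
        then show ?thesis using cls by blast
      next
        case uv: False
        have u_in: "u \<in> ?K ?B1 u" "u \<in> ?K ?B2 u"
          using u_verts by (auto simp: connected_rel_def)
        \<comment> \<open>\<open>K\<close> lies on one side: a walk inside \<open>K\<close> could
          change sides only at a vertex common to both, hence at \<open>u\<close> or
          \<open>v\<close>.\<close>
        have "K \<inter> \<Union>(ends G ` F1) = {} \<or> K \<inter> \<Union>(ends G ` F2) = {}"
        proof (rule ccontr)
          assume "\<not> ?thesis"
          then obtain x y where x: "x \<in> K" "x \<in> \<Union>(ends G ` F1)"
              and y: "y \<in> K" "y \<in> \<Union>(ends G ` F2)"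
            by blast
          have "(x, y) \<in> (adj_rel ?A)\<^sup>*"
            using reach[OF x(1)] y(1) by simp
          then have "y \<in> K \<and> y \<in> \<Union>(ends G ` F1)"
          proof induction
            case (step y z)
            then obtain f where f: "f \<in> F1 \<union> F2" "ends G f = {y, z}" "ends G f \<inter> S = {}"
              using F by (auto simp: adj_rel_def del_verts_def del_edge_def)
            then have "f \<in> F1"
              using step meet uv by blast
            have "z \<in> verts ?A"
              using f F ends_subset by (auto simp: del_verts_def del_edge_def)
            then have "z \<in> K"
              using reach[OF x(1), of z] step.hyps by (simp add: rtrancl.rtrancl_into_rtrancl)
            then show ?case
              using \<open>f \<in> F1\<close> f by auto
          qed (use x in auto)
          then show False
            using y meet uv by blast
        qed
        then show ?thesis
        proof
          assume "K \<inter> \<Union>(ends G ` F1) = {}"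
          then have "K \<in> components ?B2"
            using num_components_side[OF G e(2) _ K, of F2 F1] F uv by (auto simp: S2_def)
          then show ?thesis using uv u_in by blast
        next
          assume "K \<inter> \<Union>(ends G ` F2) = {}"
          then have "K \<in> components ?B1"
            using num_components_side[OF G e(2) _ K, of F1 F2] F uv by (auto simp: S1_def)
          then show ?thesis using uv u_in by blast
        qed
      qed
    qed
    then have "num_components ?A \<le> card ({?K ?A u, ?K ?A v} \<union> (components ?B1 - {?K ?B1 u})
        \<union> (components ?B2 - {?K ?B2 u}))"
      unfolding num_components_def using fin by (intro card_mono) auto
    also have "\<dots> \<le> card {?K ?A u, ?K ?A v} + card (components ?B1 - {?K ?B1 u})
        + card (components ?B2 - {?K ?B2 u})"
      by (meson add_le_mono card_Un_le le_refl order_trans)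
    also have "\<dots> \<le> 2 + (num_components ?B1 - 1) + (num_components ?B2 - 1)"
      using component_in[OF u_verts(1)] component_in[OF u_verts(2)]
        card_insert_le_m1[of 2 "{?K ?A v}" "?K ?A u"]
      by (intro add_mono) (simp_all add: num_components_def card_Diff_singleton)
    \<comment> \<open>Both counts are positive, as \<open>u\<close> survives in both graphs, so the
      truncated subtractions are exact.\<close>
    also have "\<dots> = num_components ?B1 + num_components ?B2"
    proof -
      have "num_components ?B1 > 0" "num_components ?B2 > 0"
        using u_verts fin component_in[of u] by (auto simp: num_components_def card_gt_0_iff)
      then show ?thesis by simp
    qed
    finally have "t * num_components ?A \<le> t * (num_components ?B1 + num_components ?B2)"
      using t by (intro mult_left_mono) linarith+
    also have "\<dots> \<le> card S1 + card S2"
      using bound[of S1] bound[of S2] nonempty links F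
      by (simp add: S1_def S2_def distrib_left) (smt (verit, best) Un_upper1 Un_upper2)
    \<comment> \<open>The two sides share at most \<open>u\<close> and \<open>v\<close>, and neither
      is in \<open>S\<close>.\<close>
    also have "\<dots> = card (S1 \<union> S2)"
    proof -
      have "S1 \<inter> S2 = {}"
        using meet False by (auto simp: S1_def S2_def)
      then show ?thesis
        using finS by (simp add: card_Un_disjoint S1_def S2_def)
    qed
    also have "\<dots> \<le> card S"
      using finS by (simp add: S1_def S2_def card_mono)
    finally show ?thesis .
  qed
qed

section \<open>Series and parallel joins\<close>

text \<open>The invariant of constructions on which the arguments about joins rely; it keeps the
  tree out of them.\<close>

definition two_terminal :: "('v, 'e) mgraph \<Rightarrow> 'v \<Rightarrow> 'v \<Rightarrow> bool" where
  "two_terminal G s t \<longleftrightarrow> s \<noteq> t \<and> s \<in> verts G \<and> t \<in> verts G \<and>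
     (\<forall>f\<in>edges G. ends G f \<subseteq> verts G) \<and> linked (ends G) (edges G) s t"

text \<open>\<open>X\<close> holds the vertices through which the rest of \<open>G\<close> may touch
  \<open>H\<close>; in use it is the pair of terminals of \<open>H\<close>.\<close>

definition attached_at :: "'v set \<Rightarrow> ('v, 'e) mgraph \<Rightarrow> ('v, 'e) mgraph \<Rightarrow> bool" where
  "attached_at X H G \<longleftrightarrow> verts H \<subseteq> verts G \<and> edges H \<subseteq> edges G \<and>
     (\<forall>f\<in>edges H. ends G f = ends H f) \<and>
     (\<forall>f\<in>edges G - edges H. ends G f \<inter> verts H \<subseteq> X)"

lemma is_unionD:
  assumes "is_union G Gs"
  shows "f \<in> edges G \<Longrightarrow> \<exists>i<length Gs. f \<in> edges (Gs ! i)"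
    and "i < length Gs \<Longrightarrow> edges (Gs ! i) \<subseteq> edges G"
    and "i < length Gs \<Longrightarrow> verts (Gs ! i) \<subseteq> verts G"
    and "i < length Gs \<Longrightarrow> f \<in> edges (Gs ! i) \<Longrightarrow> ends G f = ends (Gs ! i) f"
    and "i < length Gs \<Longrightarrow> j < length Gs \<Longrightarrow> i \<noteq> j \<Longrightarrow> edges (Gs ! i) \<inter> edges (Gs ! j) = {}"
proof -
  have mem: "Gs ! i \<in> set Gs" if "i < length Gs" for i
    using that by simp
  show "f \<in> edges G \<Longrightarrow> \<exists>i<length Gs. f \<in> edges (Gs ! i)"
    using assms by (auto simp: is_union_def in_set_conv_nth)
  show "i < length Gs \<Longrightarrow> edges (Gs ! i) \<subseteq> edges G"
    and "i < length Gs \<Longrightarrow> verts (Gs ! i) \<subseteq> verts G"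
    and "i < length Gs \<Longrightarrow> f \<in> edges (Gs ! i) \<Longrightarrow> ends G f = ends (Gs ! i) f"
    using assms mem[of i] unfolding is_union_def by blast+
  show "edges (Gs ! i) \<inter> edges (Gs ! j) = {}" if "i < length Gs" "j < length Gs" "i \<noteq> j"
  proof (cases "i < j")
    case True
    then show ?thesis using assms that by (simp add: is_union_def)
  next
    case False
    then have "edges (Gs ! j) \<inter> edges (Gs ! i) = {}"
      using assms that by (simp add: is_union_def)
    then show ?thesis by blast
  qed
qed

text \<open>Common core of both kinds of join, with \<open>l i\<close> and \<open>r i\<close> as the
  terminals of part \<open>i\<close>: constant for a parallel join, consecutive entries of a list
  for a series join. Inclusion in this pair is what both kinds guarantee for shared
  vertices.\<close>

locale join =
  fixes G :: "('v, 'e) mgraph" and Gs :: "('v, 'e) mgraph list" and k :: nat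
    and l r :: "nat \<Rightarrow> 'v"
  assumes k: "k \<ge> 2" and length_Gs: "length Gs = k"
    and union: "is_union G Gs"
    and part: "i < k \<Longrightarrow> two_terminal (Gs ! i) (l i) (r i)"
    and meet: "i < k \<Longrightarrow> j < k \<Longrightarrow> i \<noteq> j \<Longrightarrow> verts (Gs ! i) \<inter> verts (Gs ! j) \<subseteq> {l i, r i}"
begin

lemma edgeE:
  assumes "f \<in> edges G"
  obtains i where "i < k" "f \<in> edges (Gs ! i)"
  using is_unionD(1)[OF union assms] length_Gs by blast

lemmas edges_part = is_unionD(2)[OF union, unfolded length_Gs]
lemmas verts_part = is_unionD(3)[OF union, unfolded length_Gs]
lemmas ends_part = is_unionD(4)[OF union, unfolded length_Gs]
lemmas edges_disjoint = is_unionD(5)[OF union, unfolded length_Gs]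

lemma ends_verts_part: "i < k \<Longrightarrow> f \<in> edges (Gs ! i) \<Longrightarrow> ends G f \<subseteq> verts (Gs ! i)"
  using part[of i] by (simp add: ends_part two_terminal_def)

lemma ends_verts: "f \<in> edges G \<Longrightarrow> ends G f \<subseteq> verts G"
  by (erule edgeE) (meson ends_verts_part verts_part subset_trans)

lemma terminals: "i < k \<Longrightarrow> l i \<in> verts (Gs ! i)" "i < k \<Longrightarrow> r i \<in> verts (Gs ! i)"
    "i < k \<Longrightarrow> l i \<noteq> r i"
  using part[of i] by (auto simp: two_terminal_def)

lemma linked_part:
  assumes "i < k" "edges (Gs ! i) \<subseteq> F"
  shows "linked (ends G) F (l i) (r i)"
proof (rule linked_mono)
  show "linked (ends (Gs ! i)) (edges (Gs ! i)) (l i) (r i)"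
    using part[of i] assms by (simp add: two_terminal_def)
qed (use assms in \<open>auto simp: ends_part\<close>)

lemma attached_part:
  assumes "i < k"
  shows "attached_at {l i, r i} (Gs ! i) G"
proof -
  have "ends G f \<inter> verts (Gs ! i) \<subseteq> {l i, r i}" if f: "f \<in> edges G - edges (Gs ! i)" for f
  proof -
    obtain j where j: "j < k" "f \<in> edges (Gs ! j)"
      using edgeE f by blast
    then have "j \<noteq> i"
      using that by auto
    then show ?thesis
      using meet[of i j] ends_verts_part[OF j] j assms by blast
  qed
  then show ?thesis
    using assms by (simp add: attached_at_def edges_part verts_part ends_part)
qed

end

locale parallel_join = join G Gs k "\<lambda>_. s" "\<lambda>_. t" for G Gs k s t
begin

lemma two_terminal_join: "two_terminal G s t"
  using terminals[of 0] k verts_part[of 0] linked_part[of 0, OF _ edges_part] ends_verts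
  by (auto simp: two_terminal_def)

text \<open>A join has at least two parts, and any part other than \<open>i\<close> supplies the
  walk.\<close>

lemma linked_other:
  assumes "i < k"
  shows "linked (ends G) (edges G - edges (Gs ! i)) s t"
proof -
  define j where "j = (if i = 0 then 1 else 0 :: nat)"
  have "j < k" "j \<noteq> i"
    using k by (auto simp: j_def)
  then show ?thesis
    using edges_disjoint[of i j] edges_part[of j] assms by (intro linked_part[of j]) auto
qed

end

locale series_join = join G Gs k "(!) xs" "\<lambda>i. xs ! Suc i" for G Gs k xs +
  assumes inter: "i < j \<Longrightarrow> j < k \<Longrightarrow>
    verts (Gs ! i) \<inter> verts (Gs ! j) = (if j = Suc i then {xs ! j} else {})"
begin

lemma inter_subset: "i < j \<Longrightarrow> j < k \<Longrightarrow> verts (Gs ! i) \<inter> verts (Gs ! j) \<subseteq> {xs ! Suc i} \<inter> {xs ! j}"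
  using inter[of i j] by simp

lemma linked_range:
  assumes "m \<le> n" "n \<le> k" "\<And>i. m \<le> i \<Longrightarrow> i < n \<Longrightarrow> edges (Gs ! i) \<subseteq> F"
  shows "linked (ends G) F (xs ! m) (xs ! n)"
  using assms
proof (induction n rule: dec_induct)
  case (step n)
  have "linked (ends G) F (xs ! m) (xs ! n)"
    by (rule step.IH) (simp_all add: step.prems Suc_leD)
  moreover have "linked (ends G) F (xs ! n) (xs ! Suc n)"
    by (rule linked_part) (use step.hyps step.prems in simp_all)
  ultimately show ?case
    by (rule linked_trans)
qed simp

text \<open>If the outer terminals coincided, they would be a common vertex of the first and last
  parts. Then these parts are consecutive and the vertex is \<open>xs ! 1\<close>, which differs
  from \<open>xs ! 0\<close>.\<close>

lemma first_last: "xs ! 0 \<in> verts (Gs ! 0)" "xs ! k \<in> verts (Gs ! (k - 1))" "xs ! 0 \<noteq> xs ! k"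
proof -
  show first: "xs ! 0 \<in> verts (Gs ! 0)"
    by (rule terminals) (use k in simp)
  show last: "xs ! k \<in> verts (Gs ! (k - 1))"
    using terminals(2)[of "k - 1"] k by simp
  have "verts (Gs ! 0) \<inter> verts (Gs ! (k - 1)) = (if k - 1 = Suc 0 then {xs ! (k - 1)} else {})"
    by (rule inter) (use k in simp_all)
  moreover have "xs ! 0 \<noteq> xs ! Suc 0"
    by (rule terminals) (use k in simp)
  ultimately show "xs ! 0 \<noteq> xs ! k"
    using first last by (metis IntI empty_iff singletonD)
qed

lemma two_terminal_join: "two_terminal G (xs ! 0) (xs ! k)"
  unfolding two_terminal_def
proof (intro conjI ballI)
  show "linked (ends G) (edges G) (xs ! 0) (xs ! k)"
    by (rule linked_range) (simp_all add: edges_part)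
  show "xs ! 0 \<in> verts G" "xs ! k \<in> verts G"
    using first_last(1,2) verts_part[of 0] verts_part[of "k - 1"] k by auto
qed (fact first_last(3) ends_verts)+

text \<open>The parts before \<open>i\<close> form the first walk, those after \<open>i\<close> the
  second. These are the outer walks along which a property of part \<open>i\<close> is
  propagated.\<close>

lemma linked_others:
  assumes "i < k"
  shows "linked (ends G) (edges G - edges (Gs ! i)) (xs ! 0) (xs ! i)"
    and "linked (ends G) (edges G - edges (Gs ! i)) (xs ! Suc i) (xs ! k)"
proof -
  have sub: "edges (Gs ! j) \<subseteq> edges G - edges (Gs ! i)" if "j < k" "j \<noteq> i" for j
    using edges_disjoint[of i j] edges_part[of j] that assms by auto
  show "linked (ends G) (edges G - edges (Gs ! i)) (xs ! 0) (xs ! i)"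
    by (rule linked_range) (use sub assms in auto)
  show "linked (ends G) (edges G - edges (Gs ! i)) (xs ! Suc i) (xs ! k)"
    by (rule linked_range) (use sub assms in auto)
qed

text \<open>An outer terminal inside part \<open>i\<close> is shared with the first or last part, so
  it is the joint between the two, or part \<open>i\<close> is itself that end part. Hence a part
  meets the new terminals only in its own.\<close>

lemma terminal_in_part:
  assumes "i < k"
  shows "xs ! 0 \<in> verts (Gs ! i) \<Longrightarrow> xs ! 0 = xs ! i"
    and "xs ! k \<in> verts (Gs ! i) \<Longrightarrow> xs ! k = xs ! Suc i"
proof -
  show "xs ! 0 = xs ! i" if "xs ! 0 \<in> verts (Gs ! i)"
    using first_last(1) inter[of 0 i] assms that by (cases "i = 0") (auto split: if_splits)
  show "xs ! k = xs ! Suc i" if x: "xs ! k \<in> verts (Gs ! i)"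
  proof (cases "Suc i = k")
    case False
    then have "i < k - 1"
      using assms by simp
    then have "verts (Gs ! i) \<inter> verts (Gs ! (k - 1)) = (if k - 1 = Suc i then {xs ! (k - 1)} else {})"
      using k by (intro inter) auto
    then show ?thesis
      using x first_last(2) by (auto split: if_splits)
  qed simp
qed

end

section \<open>Series-parallel constructions as joins\<close>

lemma parallel_joinI:
  assumes "k \<ge> 2" "length Gs = k" "\<forall>i<k. two_terminal (Gs ! i) s t"
    "\<forall>j<k. \<forall>i<j. verts (Gs ! i) \<inter> verts (Gs ! j) = {s, t}" "is_union G Gs"
  shows "parallel_join G Gs k s t"
proof unfold_locales
  show "verts (Gs ! i) \<inter> verts (Gs ! j) \<subseteq> {s, t}" if "i < k" "j < k" "i \<noteq> j" for i j
    using assms(4) that by (metis inf_commute linorder_neqE_nat order_refl)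
qed (use assms in auto)

lemma series_joinI:
  assumes "k \<ge> 2" "length Gs = k" "\<forall>i<k. two_terminal (Gs ! i) (xs ! i) (xs ! Suc i)"
    and *: "\<forall>j<k. \<forall>i<j. verts (Gs ! i) \<inter> verts (Gs ! j) = (if j = Suc i then {xs ! j} else {})"
    and "is_union G Gs"
  shows "series_join G Gs k xs"
proof unfold_locales
  show "verts (Gs ! i) \<inter> verts (Gs ! j) \<subseteq> {xs ! i, xs ! Suc i}"
    if "i < k" "j < k" "i \<noteq> j" for i j
  proof (cases "i < j")
    case True
    then show ?thesis using * that by auto
  next
    case False
    then have "verts (Gs ! j) \<inter> verts (Gs ! i) = (if i = Suc j then {xs ! i} else {})"
      using * that by auto
    then show ?thesis by (auto split: if_splits)
  qed
qed (use assms in auto)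

lemma two_terminal_sp:
  "sp_construction G s t T \<Longrightarrow> two_terminal G s t"
proof (induction rule: sp_construction.induct)
  case (edge s t G e)
  then show ?case
    by (auto simp: two_terminal_def intro: linked_edge)
next
  case (series k Gs Ts xs G s t)
  interpret series_join G Gs k xs
    by (rule series_joinI) (use series in auto)
  show ?case
    using two_terminal_join series by simp
next
  case (parallel k Gs Ts s t G)
  interpret parallel_join G Gs k s t
    by (rule parallel_joinI) (use parallel in auto)
  show ?case
    by (rule two_terminal_join)
qed

lemma sp_LeafD: "sp_construction G s t (Leaf e) \<Longrightarrow> edges G = {e} \<and> ends G e = {s, t}"
  by (auto elim: sp_construction.cases)

lemma sp_SeriesE:
  assumes "sp_construction G s t (Series Ts)"
  obtains Gs xs where "series_join G Gs (length Ts) xs" "s = xs ! 0" "t = xs ! length Ts"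
    "\<And>i. i < length Ts \<Longrightarrow> sp_construction (Gs ! i) (xs ! i) (xs ! Suc i) (Ts ! i)"
  using assms
proof cases
  case (series k Gs xs)
  then have "series_join G Gs k xs"
    by (intro series_joinI) (auto intro: two_terminal_sp)
  then show ?thesis
    using series that by auto
qed

lemma sp_ParallelE:
  assumes "sp_construction G s t (Parallel Ts)"
  obtains Gs where "parallel_join G Gs (length Ts) s t"
    "\<And>i. i < length Ts \<Longrightarrow> sp_construction (Gs ! i) s t (Ts ! i)"
  using assms
proof cases
  case (parallel k Gs)
  then have "parallel_join G Gs k s t"
    by (intro parallel_joinI) (auto intro: two_terminal_sp)
  then show ?thesis
    using parallel that by auto
qed

text \<open>A property of an edge of a part is passed on to the whole construction, once it survives
  attaching a part at its terminals to paths from the new terminals.\<close>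

lemma sp_propagate:
  assumes "sp_construction G s t T"
    and "N \<in> nodes T"
    and top: "\<And>G s t. sp_construction G s t N \<Longrightarrow> P G s t"
    and step: "\<And>H G s t s' t'. P H s t \<Longrightarrow> two_terminal H s t \<Longrightarrow> attached_at {s, t} H G \<Longrightarrow>
      {s', t'} \<inter> verts H \<subseteq> {s, t} \<Longrightarrow>
      linked (ends G) (edges G - edges H) s' s \<Longrightarrow>
      linked (ends G) (edges G - edges H) t t' \<Longrightarrow> P G s' t'"
  shows "P G s t"
  using assms(1,2)
proof (induction T arbitrary: G s t rule: sptree.induct)
  case (Leaf e)
  then show ?case using top by simp
next
  case (Series Ts)
  show ?case
  proof (cases "N = Series Ts")
    case False
    obtain Gs xs where J: "series_join G Gs (length Ts) xs"
        and st: "s = xs ! 0" "t = xs ! length Ts"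
        and parts: "\<And>i. i < length Ts \<Longrightarrow> sp_construction (Gs ! i) (xs ! i) (xs ! Suc i) (Ts ! i)"
      by (rule sp_SeriesE[OF Series.prems(1)]) (rule that)
    interpret series_join G Gs "length Ts" xs by (rule J)
    obtain i where i: "i < length Ts" "N \<in> nodes (Ts ! i)"
      using Series.prems(2) False by (auto simp: in_set_conv_nth)
    have "P (Gs ! i) (xs ! i) (xs ! Suc i)"
      using Series.IH[OF nth_mem[OF i(1)] parts[OF i(1)] i(2)] .
    then show ?thesis
      unfolding st
      by (rule step[OF _ part[OF i(1)] attached_part[OF i(1)]])
        (use linked_others[OF i(1)] terminal_in_part[OF i(1)] in auto)
  qed (use Series top in simp)
next
  case (Parallel Ts)
  show ?case
  proof (cases "N = Parallel Ts")
    case False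
    obtain Gs where J: "parallel_join G Gs (length Ts) s t"
        and parts: "\<And>i. i < length Ts \<Longrightarrow> sp_construction (Gs ! i) s t (Ts ! i)"
      by (rule sp_ParallelE[OF Parallel.prems(1)]) (rule that)
    interpret parallel_join G Gs "length Ts" s t by (rule J)
    obtain i where i: "i < length Ts" "N \<in> nodes (Ts ! i)"
      using Parallel.prems(2) False by (auto simp: in_set_conv_nth)
    have "P (Gs ! i) s t"
      using Parallel.IH[OF nth_mem[OF i(1)] parts[OF i(1)] i(2)] .
    \<comment> \<open>A parallel join keeps the terminals, so both outer walks are trivial.\<close>
    then show ?thesis
      by (rule step[OF _ part[OF i(1)] attached_part[OF i(1)]]) auto
  qed (use Parallel top in simp)
qed

section \<open>Edges below series nodes\<close>

text \<open>The joint of the first two parts is a cut vertex between the terminals; \<open>A\<close>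
  is the first part without it.\<close>

lemma series_cut:
  assumes "sp_construction G s t (Series Ts)"
  shows "\<exists>x A. x \<in> verts G \<and> x \<notin> {s, t} \<and> s \<in> A \<and> t \<notin> A \<and>
    (\<forall>f\<in>edges G. ends G f \<inter> A = {} \<or> ends G f \<subseteq> A \<union> {x})"
proof -
  obtain Gs xs where J: "series_join G Gs (length Ts) xs" and st: "s = xs ! 0" "t = xs ! length Ts"
    by (rule sp_SeriesE[OF assms]) blast
  interpret series_join G Gs "length Ts" xs by (rule J)
  let ?x = "xs ! 1" and ?A = "verts (Gs ! 0) - {xs ! 1}"
  have pos: "0 < length Ts" "1 < length Ts"
    using k by linarith+
  have s: "s \<in> verts (Gs ! 0)" "s \<noteq> ?x" "?x \<in> verts (Gs ! 0)"
    using terminals[OF pos(1)] st by auto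
  \<comment> \<open>Otherwise \<open>t\<close> is the first joint, which also lies in the second
    part, and so \<open>t\<close> is the second joint too; but the two ends of the second part
    differ.\<close>
  have t: "t \<notin> verts (Gs ! 0)"
  proof
    assume "t \<in> verts (Gs ! 0)"
    then have "t = ?x"
      using terminal_in_part(2)[OF pos(1)] st by simp
    moreover have "?x \<in> verts (Gs ! 1)"
      by (rule terminals(1)[OF pos(2)])
    ultimately have "xs ! 1 = xs ! Suc 1"
      using terminal_in_part(2)[OF pos(2)] st by simp
    then show False
      using terminals(3)[OF pos(2)] by contradiction
  qed
  have "ends G f \<inter> ?A = {} \<or> ends G f \<subseteq> ?A \<union> {?x}" if f: "f \<in> edges G" for f
  proof -
    obtain j where j: "j < length Ts" "f \<in> edges (Gs ! j)"
      using edgeE f by blast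
    show ?thesis
    proof (cases "j = 0")
      case True
      then show ?thesis
        using ends_verts_part[OF j] by blast
    next
      case False
      then show ?thesis
        using ends_verts_part[OF j] inter_subset[of 0 j] j(1) by auto
    qed
  qed
  moreover have "?x \<in> verts G"
    using s verts_part[OF pos(1)] by auto
  ultimately show ?thesis
    using s t by (intro exI[of _ ?x] exI[of _ ?A]) blast
qed

text \<open>Without \<open>e\<close>, the vertex \<open>x\<close> alone cuts \<open>A\<close> off
  from the rest. As \<open>A\<close> avoids the terminals, edges attached there later cannot touch
  it; \<open>x\<close> itself may be a terminal. The element \<open>y\<close> makes \<open>A\<close>
  nonempty.\<close>

definition separable_without :: "'e \<Rightarrow> ('v, 'e) mgraph \<Rightarrow> 'v \<Rightarrow> 'v \<Rightarrow> bool" where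
  "separable_without e G s t \<longleftrightarrow> (\<exists>x A y. x \<in> verts G \<and> A \<subseteq> verts G \<and> y \<in> A \<and> x \<notin> A \<and>
     s \<notin> A \<and> t \<notin> A \<and> (\<forall>f\<in>edges G - {e}. ends G f \<inter> A = {} \<or> ends G f \<subseteq> A \<union> {x}))"

lemma separable_withoutI:
  assumes "x \<in> verts G" "A \<subseteq> verts G" "y \<in> A" "x \<notin> A" "s \<notin> A" "t \<notin> A"
    and "\<And>f. f \<in> edges G - {e} \<Longrightarrow> ends G f \<inter> A = {} \<or> ends G f \<subseteq> A \<union> {x}"
  shows "separable_without e G s t"
  unfolding separable_without_def
  by (intro exI[of _ x] exI[of _ A] exI[of _ y] conjI ballI; fact)

text \<open>Without \<open>e\<close>, a part next to \<open>e\<close> hangs on to the rest only at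
  its far terminal. That terminal is \<open>x\<close>, the remainder of the neighbouring part is
  \<open>A\<close>, and \<open>y\<close> is the former end of \<open>e\<close> in it. The neighbour
  is the second part if \<open>e\<close> comes first, else the part preceding
  \<open>e\<close>.\<close>

lemma separable_series_edge:
  assumes "sp_construction G s t (Series Ts)" and "Leaf e \<in> set Ts"
  shows "separable_without e G s t"
proof -
  obtain Gs xs where J: "series_join G Gs (length Ts) xs"
      and st: "s = xs ! 0" "t = xs ! length Ts"
      and parts: "\<And>i. i < length Ts \<Longrightarrow> sp_construction (Gs ! i) (xs ! i) (xs ! Suc i) (Ts ! i)"
    by (rule sp_SeriesE[OF assms(1)]) (rule that)
  interpret series_join G Gs "length Ts" xs by (rule J)
  obtain i where i: "i < length Ts" "Ts ! i = Leaf e"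
    using assms(2) by (auto simp: in_set_conv_nth)
  have e: "edges (Gs ! i) = {e}"
    using parts[OF i(1)] i(2) sp_LeafD by metis
  have other: "j \<noteq> i" if "f \<in> edges G - {e}" "f \<in> edges (Gs ! j)" for f j
    using that e by (metis DiffD2)
  show ?thesis
  proof (cases i)
    case 0
    let ?x = "xs ! Suc 1" and ?A = "verts (Gs ! 1) - {xs ! Suc 1}"
    have pos: "0 < length Ts" "1 < length Ts"
      using k by linarith+
    have x: "?x \<in> verts (Gs ! 1)" "xs ! 1 \<in> ?A"
      using terminals[OF pos(2)] by auto
    have sA: "s \<notin> ?A"
      using terminal_in_part(1)[OF pos(2)] terminals(3)[OF pos(1)] unfolding st One_nat_def by blast
    have tA: "t \<notin> ?A"
      using terminal_in_part(2)[OF pos(2)] unfolding st by blast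
    have edges_A: "ends G f \<inter> ?A = {} \<or> ends G f \<subseteq> ?A \<union> {?x}" if f: "f \<in> edges G - {e}" for f
    proof -
      obtain j where j: "j < length Ts" "f \<in> edges (Gs ! j)"
        using edgeE f by blast
      have "j \<noteq> 0"
        using other[OF f j(2)] 0 by simp
      show ?thesis
      proof (cases "j = 1")
        case True
        then show ?thesis
          using ends_verts_part[OF j] by blast
      next
        case False
        then have "verts (Gs ! 1) \<inter> verts (Gs ! j) \<subseteq> {?x}"
          using inter_subset[of 1 j] \<open>j \<noteq> 0\<close> j(1) by simp
        then show ?thesis
          using ends_verts_part[OF j] by blast
      qed
    qed
    have A: "verts (Gs ! 1) \<subseteq> verts G"
      by (rule verts_part[OF pos(2)])
    have G: "?x \<in> verts G" "?A \<subseteq> verts G" "?x \<notin> ?A"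
      using x(1) A by auto
    show ?thesis
      by (rule separable_withoutI[OF G(1,2) x(2) G(3) sA tA]) (rule edges_A)
  next
    case (Suc m)
    let ?x = "xs ! m" and ?A = "verts (Gs ! m) - {xs ! m}"
    have m: "m < length Ts"
      using Suc i by simp
    have x: "?x \<in> verts (Gs ! m)" "xs ! Suc m \<in> ?A"
      using terminals[of m] m by auto
    have sA: "s \<notin> ?A"
      using terminal_in_part(1)[OF m] unfolding st by blast
    \<comment> \<open>If \<open>t\<close> were in \<open>A\<close>, it would be the left end of
      \<open>e\<close>; lying in the part of \<open>e\<close>, it would also be the right
      end.\<close>
    have tA: "t \<notin> ?A"
    proof
      assume "t \<in> ?A"
      then have t: "t = xs ! i"
        using terminal_in_part(2)[OF m] unfolding st Suc by blast
      then have "t = xs ! Suc i"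
        using terminal_in_part(2)[OF i(1)] terminals(1)[OF i(1)] st(2) by metis
      then show False
        using t terminals(3)[OF i(1)] by simp
    qed
    have edges_A: "ends G f \<inter> ?A = {} \<or> ends G f \<subseteq> ?A \<union> {?x}" if f: "f \<in> edges G - {e}" for f
    proof -
      obtain j where j: "j < length Ts" "f \<in> edges (Gs ! j)"
        using edgeE f by blast
      have "j \<noteq> Suc m"
        using other[OF f j(2)] Suc by simp
      show ?thesis
      proof (cases "j = m")
        case True
        then show ?thesis
          using ends_verts_part[OF j] by blast
      next
        case False
        then have "verts (Gs ! m) \<inter> verts (Gs ! j) \<subseteq> {?x}"
          using inter[of m j] inter_subset[of j m] \<open>j \<noteq> Suc m\<close> j(1) m
          by (cases "j < m") auto
        then show ?thesis
          using ends_verts_part[OF j] by blast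
      qed
    qed
    have A: "verts (Gs ! m) \<subseteq> verts G"
      using verts_part[of m] m by auto
    have G: "?x \<in> verts G" "?A \<subseteq> verts G" "?x \<notin> ?A"
      using x(1) A by auto
    show ?thesis
      by (rule separable_withoutI[OF G(1,2) x(2) G(3) sA tA]) (rule edges_A)
  qed
qed

lemma separable_attached:
  assumes "separable_without e H s t" "attached_at {s, t} H G"
    and "{s', t'} \<inter> verts H \<subseteq> {s, t}"
  shows "separable_without e G s' t'"
proof -
  obtain x A y where A: "x \<in> verts H" "A \<subseteq> verts H" "y \<in> A" "x \<notin> A" "s \<notin> A" "t \<notin> A"
      and edges_A: "\<forall>f\<in>edges H - {e}. ends H f \<inter> A = {} \<or> ends H f \<subseteq> A \<union> {x}"
    using assms(1) unfolding separable_without_def by (elim exE conjE) (rule that)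
  have new: "ends G f \<inter> A = {} \<or> ends G f \<subseteq> A \<union> {x}" if f: "f \<in> edges G - {e}" for f
  proof (cases "f \<in> edges H")
    case True
    then have "ends G f = ends H f"
      using assms(2) by (simp add: attached_at_def)
    then show ?thesis
      using bspec[OF edges_A, of f] f True by simp
  next
    case False
    then have "ends G f \<inter> verts H \<subseteq> {s, t}"
      using f assms(2) by (simp add: attached_at_def)
    then have "ends G f \<inter> A = {}"
      using A(2,5,6) by blast
    then show ?thesis ..
  qed
  have "verts H \<subseteq> verts G"
    using assms(2) by (simp add: attached_at_def)
  then have G: "x \<in> verts G" "A \<subseteq> verts G" "s' \<notin> A" "t' \<notin> A"
    using A(1,2,5,6) assms(3) by blast+
  show ?thesis
    by (rule separable_withoutI[OF G(1,2) A(3,4) G(3,4)]) (rule new)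
qed

lemma toughness_del_series_edge:
  assumes "multigraph G" "sp_construction G s t T"
    and "Series Ts \<in> nodes T" "Leaf e \<in> set Ts"
  shows "toughness (del_edge G e) \<le> ereal (1/2)"
proof -
  have "separable_without e G s t"
    by (rule sp_propagate[OF assms(2,3), where P = "separable_without e"])
      (erule separable_series_edge[OF _ assms(4)], rule separable_attached)
  then obtain x A y where A: "x \<in> verts G" "A \<subseteq> verts G" "y \<in> A" "x \<notin> A" "s \<notin> A" "t \<notin> A"
      and edges_A: "\<forall>f\<in>edges G - {e}. ends G f \<inter> A = {} \<or> ends G f \<subseteq> A \<union> {x}"
    unfolding separable_without_def by (elim exE conjE) (rule that)
  have "s \<noteq> t" "s \<in> verts G" "t \<in> verts G"
    using two_terminal_sp[OF assms(2)] by (auto simp: two_terminal_def)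
  \<comment> \<open>At least one of the two distinct terminals differs from
    \<open>x\<close>.\<close>
  then obtain z where z: "z \<in> verts G" "z \<notin> A" "z \<noteq> x"
    using A(5,6) by metis
  show ?thesis
  proof (rule toughness_le_half)
    show "finite (verts (del_edge G e))" "{x} \<subseteq> verts (del_edge G e)"
        "y \<in> verts (del_edge G e) - {x}" "z \<in> verts (del_edge G e) - {x}"
      using A z multigraph.finite_verts[OF assms(1)] by (auto simp: del_edge_def)
    show "ends (del_edge G e) f \<inter> A = {} \<or> ends (del_edge G e) f \<subseteq> A \<union> {x}"
      if "f \<in> edges (del_edge G e)" for f
      using bspec[OF edges_A, of f] that by (simp add: del_edge_def)
  qed (simp_all add: A z)
qed

section \<open>Edges below parallel nodes\<close>

text \<open>\<open>F\<close> is a local detour around \<open>e\<close>, while \<open>F'\<close>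
  leads from the ends of \<open>e\<close> out to the terminals. Counting \<open>s\<close> and
  \<open>t\<close> with the vertices of \<open>F'\<close> keeps the overlap inside
  \<open>{u, v}\<close> when edges attached at the terminals join \<open>F'\<close> later.\<close>

definition bypassed :: "'e \<Rightarrow> ('v, 'e) mgraph \<Rightarrow> 'v \<Rightarrow> 'v \<Rightarrow> bool" where
  "bypassed e G s t \<longleftrightarrow> (\<exists>u v F F'. e \<in> edges G \<and> ends G e = {u, v} \<and> F \<union> F' = edges G - {e} \<and>
     linked (ends G) F u v \<and> linked (ends G) F' s u \<and> linked (ends G) F' v t \<and>
     \<Union>(ends G ` F) \<inter> (\<Union>(ends G ` F') \<union> {s, t}) \<subseteq> {u, v})"

lemma bypassedI:
  assumes "e \<in> edges G" "ends G e = {u, v}" "F \<union> F' = edges G - {e}"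
    and "linked (ends G) F u v" "linked (ends G) F' s u" "linked (ends G) F' v t"
    and "\<Union>(ends G ` F) \<inter> (\<Union>(ends G ` F') \<union> {s, t}) \<subseteq> {u, v}"
  shows "bypassed e G s t"
  unfolding bypassed_def
  by (intro exI[of _ u] exI[of _ v] exI[of _ F] exI[of _ F'] conjI; fact)

lemma bypassed_parallel_edge:
  assumes "sp_construction G s t (Parallel Ts)" and "Leaf e \<in> set Ts"
  shows "bypassed e G s t"
proof -
  obtain Gs where J: "parallel_join G Gs (length Ts) s t"
      and parts: "\<And>i. i < length Ts \<Longrightarrow> sp_construction (Gs ! i) s t (Ts ! i)"
    by (rule sp_ParallelE[OF assms(1)]) (rule that)
  interpret parallel_join G Gs "length Ts" s t by (rule J)
  obtain i where i: "i < length Ts" "Ts ! i = Leaf e"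
    using assms(2) by (auto simp: in_set_conv_nth)
  have e: "edges (Gs ! i) = {e}" "ends (Gs ! i) e = {s, t}"
    using parts[OF i(1)] i(2) sp_LeafD by metis+
  have eG: "e \<in> edges G" "ends G e = {s, t}"
    using e edges_part[OF i(1)] ends_part[OF i(1), of e] by auto
  show ?thesis
    \<comment> \<open>The ends of \<open>e\<close> are the terminals themselves, so the outer walks
      are trivial and all remaining edges form the detour.\<close>
    by (rule bypassedI[OF eG, where F = "edges G - {e}" and F' = "{}"])
      (use linked_other[OF i(1)] e(1) in simp_all)
qed

text \<open>The detour stays as it is and every edge outside \<open>H\<close> goes to
  \<open>F'\<close>. Such an edge meets \<open>H\<close> only in \<open>s\<close> and
  \<open>t\<close>, and whichever of these lies on the detour is an end of \<open>e\<close>.\<close>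

lemma bypassed_attached:
  assumes "bypassed e H s t" "two_terminal H s t" "attached_at {s, t} H G"
    and "{s', t'} \<inter> verts H \<subseteq> {s, t}"
    and "linked (ends G) (edges G - edges H) s' s" "linked (ends G) (edges G - edges H) t t'"
  shows "bypassed e G s' t'"
proof -
  obtain u v F F' where e: "e \<in> edges H" "ends H e = {u, v}" and F: "F \<union> F' = edges H - {e}"
      and links: "linked (ends H) F u v" "linked (ends H) F' s u" "linked (ends H) F' v t"
      and meet: "\<Union>(ends H ` F) \<inter> (\<Union>(ends H ` F') \<union> {s, t}) \<subseteq> {u, v}"
    using assms(1) unfolding bypassed_def by (elim exE conjE) (rule that)
  have G: "edges H \<subseteq> edges G" "\<And>f. f \<in> edges H \<Longrightarrow> ends G f = ends H f"
      "\<And>f. f \<in> edges G - edges H \<Longrightarrow> ends G f \<inter> verts H \<subseteq> {s, t}"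
    using assms(3) by (auto simp: attached_at_def)
  let ?F' = "F' \<union> (edges G - edges H)"
  have FH: "F \<subseteq> edges H" "F' \<subseteq> edges H"
    using F by auto
  have F_un: "F \<union> ?F' = edges G - {e}"
    using F G(1) e(1) by blast
  have eqF: "ends G f = ends H f" if "f \<in> F \<or> f \<in> F'" for f
    using that FH G(2) by blast
  have link: "linked (ends G) F u v"
    by (rule linked_mono[OF links(1)]) (simp_all add: eqF)
  have "linked (ends G) ?F' s' s"
    by (rule linked_mono[OF assms(5)]) auto
  moreover have "linked (ends G) ?F' s u"
    by (rule linked_mono[OF links(2)]) (simp_all add: eqF)
  ultimately have su: "linked (ends G) ?F' s' u"
    by (rule linked_trans)
  have "linked (ends G) ?F' v t"
    by (rule linked_mono[OF links(3)]) (simp_all add: eqF)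
  moreover have "linked (ends G) ?F' t t'"
    by (rule linked_mono[OF assms(6)]) auto
  ultimately have vt: "linked (ends G) ?F' v t'"
    by (rule linked_trans)
  have sep: "\<Union>(ends G ` F) \<inter> (\<Union>(ends G ` ?F') \<union> {s', t'}) \<subseteq> {u, v}"
  proof -
    have eq: "\<Union>(ends G ` F) = \<Union>(ends H ` F)" "\<Union>(ends G ` F') = \<Union>(ends H ` F')"
      using eqF by simp_all
    have "\<Union>(ends H ` F) \<subseteq> verts H"
      using FH(1) assms(2) unfolding two_terminal_def by blast
    then have "\<Union>(ends H ` F) \<inter> (\<Union>(ends G ` (edges G - edges H)) \<union> {s', t'}) \<subseteq> {s, t}"
      using G(3) assms(4) by blast
    then show ?thesis
      unfolding image_Un Union_Un_distrib eq using meet by blast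
  qed
  have "e \<in> edges G" "ends G e = {u, v}"
    using e G(1,2) by auto
  then show ?thesis
    using F_un link su vt sep by (rule bypassedI)
qed

text \<open>Within the child \<open>U\<close> of the root, \<open>e\<close> has a detour and outer
  walks to the terminals. A sibling of \<open>U\<close> closes these outer walks to a second walk
  between the ends of \<open>e\<close>.\<close>

lemma tough_del_nested_edge:
  assumes G: "multigraph G" "0 \<le> r" "r \<le> 1" "tough r G"
    and "sp_construction G s t (Parallel Us)"
    and U: "U \<in> set Us" "Parallel Ts \<in> nodes U" "Leaf e \<in> set Ts"
  shows "tough r (del_edge G e)"
proof -
  obtain Gs where J: "parallel_join G Gs (length Us) s t"
      and parts: "\<And>i. i < length Us \<Longrightarrow> sp_construction (Gs ! i) s t (Us ! i)"
    by (rule sp_ParallelE[OF assms(5)]) (rule that)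
  interpret parallel_join G Gs "length Us" s t by (rule J)
  obtain i where i: "i < length Us" "Us ! i = U"
    using U(1) by (auto simp: in_set_conv_nth)
  have "bypassed e (Gs ! i) s t"
    by (rule sp_propagate[OF parts[OF i(1), unfolded i(2)] U(2), where P = "bypassed e"])
      (erule bypassed_parallel_edge[OF _ U(3)], rule bypassed_attached)
  then obtain u v F F' where e: "e \<in> edges (Gs ! i)" "ends (Gs ! i) e = {u, v}"
      and F: "F \<union> F' = edges (Gs ! i) - {e}"
      and links: "linked (ends (Gs ! i)) F u v"
        "linked (ends (Gs ! i)) F' s u" "linked (ends (Gs ! i)) F' v t"
      and meet: "\<Union>(ends (Gs ! i) ` F) \<inter> (\<Union>(ends (Gs ! i) ` F') \<union> {s, t}) \<subseteq> {u, v}"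
    unfolding bypassed_def by (elim exE conjE) (rule that)
  have H: "edges (Gs ! i) \<subseteq> edges G" "\<And>f. f \<in> edges (Gs ! i) \<Longrightarrow> ends G f = ends (Gs ! i) f"
      "\<And>f. f \<in> edges G - edges (Gs ! i) \<Longrightarrow> ends G f \<inter> verts (Gs ! i) \<subseteq> {s, t}"
    using attached_part[OF i(1)] by (auto simp: attached_at_def)
  have FH: "F \<subseteq> edges (Gs ! i)" "F' \<subseteq> edges (Gs ! i)"
    using F by auto
  let ?F' = "F' \<union> (edges G - edges (Gs ! i))"
  have eG: "e \<in> edges G" "ends G e = {u, v}"
    using e H(1,2) by auto
  have F_un: "F \<union> ?F' = edges G - {e}"
    using F H(1) e(1) by blast
  have eqF: "ends G f = ends (Gs ! i) f" if "f \<in> F \<or> f \<in> F'" for f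
    using that FH H(2) by blast
  have link: "linked (ends G) F u v"
    by (rule linked_mono[OF links(1)]) (simp_all add: eqF)
  have "linked (ends G) ?F' s u"
    by (rule linked_mono[OF links(2)]) (simp_all add: eqF)
  moreover have "linked (ends G) ?F' v t"
    by (rule linked_mono[OF links(3)]) (simp_all add: eqF)
  moreover have "linked (ends G) ?F' s t"
    by (rule linked_mono[OF linked_other[OF i(1)]]) auto
  \<comment> \<open>The route is \<open>u\<close> to \<open>s\<close>, across a sibling to
    \<open>t\<close>, and on to \<open>v\<close>.\<close>
  ultimately have link': "linked (ends G) ?F' u v"
    by (meson linked_sym linked_trans)
  have eq: "\<Union>(ends G ` F) = \<Union>(ends (Gs ! i) ` F)" "\<Union>(ends G ` F') = \<Union>(ends (Gs ! i) ` F')"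
    using eqF by simp_all
  have "\<Union>(ends (Gs ! i) ` F) \<subseteq> verts (Gs ! i)"
    using FH(1) part[OF i(1)] unfolding two_terminal_def by blast
  then have "\<Union>(ends (Gs ! i) ` F) \<inter> \<Union>(ends G ` (edges G - edges (Gs ! i))) \<subseteq> {s, t}"
    using H(3) by blast
  then have "\<Union>(ends G ` F) \<inter> \<Union>(ends G ` ?F') \<subseteq> {u, v}"
    unfolding image_Un Union_Un_distrib eq using meet by blast
  then show ?thesis
    by (rule tough_del_edge[OF G eG F_un _ link link'])
qed

text \<open>Two further children provide the two sides. With a single sibling, alternation and the
  exclusion of leap-edges leave only an edge parallel to \<open>e\<close>, whose deletion does no
  harm.\<close>

lemma tough_del_root_edge:
  assumes G: "multigraph G" "0 \<le> r" "r \<le> 1" "tough r G"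
    and sp: "sp_construction G s t (Parallel Ts)"
    and e: "Leaf e \<in> set Ts" "\<not> leap_edge (Parallel Ts) e"
    and alt: "alternating (Parallel Ts)"
  shows "tough r (del_edge G e)"
proof -
  obtain Gs where J: "parallel_join G Gs (length Ts) s t"
      and parts: "\<And>i. i < length Ts \<Longrightarrow> sp_construction (Gs ! i) s t (Ts ! i)"
    by (rule sp_ParallelE[OF sp]) (rule that)
  interpret parallel_join G Gs "length Ts" s t by (rule J)
  obtain i where i: "i < length Ts" "Ts ! i = Leaf e"
    using e(1) by (auto simp: in_set_conv_nth)
  have ei: "edges (Gs ! i) = {e}" "ends (Gs ! i) e = {s, t}"
    using parts[OF i(1)] i(2) sp_LeafD by metis+
  have eG: "e \<in> edges G" "ends G e = {s, t}"
    using ei edges_part[OF i(1)] ends_part[OF i(1)] by auto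
  show ?thesis
  proof (cases "length Ts = 2")
    case True
    then obtain U V where Ts: "Ts = [U, V]"
      by (auto simp: numeral_2_eq_2 length_Suc_conv)
    define j where "j = 1 - i"
    have j: "j < length Ts" "j \<noteq> i"
      using i(1) True unfolding j_def by presburger+
    have "Ts ! j \<noteq> Parallel Ws" for Ws
      using alt j(1) nth_mem[of j Ts] by (fastforce simp: alternating_def)
    moreover have "Ts ! j \<noteq> Series Ws" for Ws
    proof
      assume "Ts ! j = Series Ws"
      moreover have "i = 0 \<or> i = 1"
        using i True by auto
      ultimately show False
        using e(2) i(2) Ts by (auto simp: leap_edge_def j_def)
    qed
    ultimately obtain f where "Ts ! j = Leaf f"
      by (cases "Ts ! j") auto
    then have f: "edges (Gs ! j) = {f}"
      using parts[OF j(1)] sp_LeafD by metis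
    have link: "linked (ends G) (edges G - {e}) s t"
      using linked_other[OF i(1)] ei by simp
    have "edges G - {e} \<subseteq> {f}"
    proof
      fix g assume g: "g \<in> edges G - {e}"
      then obtain m where "m < length Ts" "g \<in> edges (Gs ! m)"
        using edgeE g by blast
      moreover from this have "m = i \<or> m = j"
        using i(1) True unfolding j_def by presburger
      ultimately show "g \<in> {f}"
        using f ei g by auto
    qed
    moreover have "ends G f = {s, t}"
      using parts[OF j(1)] \<open>Ts ! j = Leaf f\<close> sp_LeafD ends_part[OF j(1), of f] f
      by (metis singletonI)
    ultimately have "\<Union>(ends G ` (edges G - {e})) \<subseteq> {s, t}"
      by blast
    \<comment> \<open>The parallel edge serves as both sides at once: all remaining ends lie in
      \<open>{s, t}\<close>, so the overlap condition holds even for equal sides.\<close>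
    then show ?thesis
      by (intro tough_del_edge[OF G eG Un_absorb _ link link]) simp
  next
    case False
    \<comment> \<open>Indices of two children distinct from each other and from \<open>e\<close>:
      the two smallest other than \<open>i\<close>.\<close>
    define j where "j = (if i = 0 then 1 else 0 :: nat)"
    define m where "m = (if i < 2 then 2 else 1 :: nat)"
    have "length Ts \<ge> 3"
      using k False by simp
    then have j: "j < length Ts" "j \<noteq> i" and m: "m < length Ts" "m \<noteq> i" "m \<noteq> j"
      by (auto simp: j_def m_def)
    let ?F1 = "edges (Gs ! j)" and ?F2 = "edges G - {e} - edges (Gs ! j)"
    show ?thesis
    proof (rule tough_del_edge[OF G eG])
      show "?F1 \<union> ?F2 = edges G - {e}"
        using edges_part[OF j(1)] edges_disjoint[OF i(1) j(1)] j ei by auto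
      show "linked (ends G) ?F1 s t"
        using linked_part[OF j(1)] by simp
      show "linked (ends G) ?F2 s t"
        using edges_part[OF m(1)] edges_disjoint[OF i(1) m(1)] edges_disjoint[OF j(1) m(1)] m ei
        by (intro linked_part[OF m(1)]) auto
      have "\<Union>(ends G ` ?F1) \<subseteq> verts (Gs ! j)"
        using ends_verts_part[OF j(1)] by blast
      moreover have "\<Union>(ends G ` ?F2) \<inter> verts (Gs ! j) \<subseteq> {s, t}"
        using attached_part[OF j(1)] unfolding attached_at_def by blast
      ultimately show "\<Union>(ends G ` ?F1) \<inter> \<Union>(ends G ` ?F2) \<subseteq> {s, t}"
        by blast
    qed
  qed
qed

text \<open>The series sibling is all that remains, and its first joint separates \<open>s\<close>
  from \<open>t\<close>.\<close>

lemma toughness_del_leap_edge: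
  assumes "multigraph G" and sp: "sp_construction G s t T" and "leap_edge T e"
  shows "toughness (del_edge G e) \<le> ereal (1/2)"
proof -
  obtain Ts where T: "T = Parallel [Leaf e, Series Ts] \<or> T = Parallel [Series Ts, Leaf e]"
    using assms(3) by (auto simp: leap_edge_def)
  then obtain Us where Us: "T = Parallel Us" by auto
  obtain Gs where J: "parallel_join G Gs (length Us) s t"
      and parts: "\<And>i. i < length Us \<Longrightarrow> sp_construction (Gs ! i) s t (Us ! i)"
    by (rule sp_ParallelE[OF sp[unfolded Us]]) (rule that)
  interpret parallel_join G Gs "length Us" s t by (rule J)
  obtain i j where ij: "i < length Us" "j < length Us" "\<And>m. m < length Us \<Longrightarrow> m = i \<or> m = j"
      "Us ! i = Leaf e" "Us ! j = Series Ts"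
  proof (cases "Us = [Leaf e, Series Ts]")
    case True
    then show ?thesis using that[of 0 1] by (auto simp: less_Suc_eq)
  next
    case False
    then have "Us = [Series Ts, Leaf e]" using T Us by auto
    then show ?thesis using that[of 1 0] by (auto simp: less_Suc_eq)
  qed
  have ei: "edges (Gs ! i) = {e}"
    using parts[OF ij(1)] ij(4) sp_LeafD by metis
  have cut: "sp_construction (Gs ! j) s t (Series Ts)"
    using parts[OF ij(2)] ij(5) by simp
  obtain x A where A: "x \<in> verts (Gs ! j)" "x \<notin> {s, t}" "s \<in> A" "t \<notin> A"
      and edges_A: "\<forall>f\<in>edges (Gs ! j).
        ends (Gs ! j) f \<inter> A = {} \<or> ends (Gs ! j) f \<subseteq> A \<union> {x}"
    using series_cut[OF cut] by auto
  have "ends G f \<inter> A = {} \<or> ends G f \<subseteq> A \<union> {x}" if f: "f \<in> edges G - {e}" for f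
  proof -
    obtain m where m: "m < length Us" "f \<in> edges (Gs ! m)"
      using edgeE f by blast
    have "m \<noteq> i"
      using m(2) ei f by blast
    then have "m = j"
      using ij(3)[OF m(1)] by blast
    then show ?thesis
      using bspec[OF edges_A, of f] ends_part[OF m] m(2) by simp
  qed
  then have edges_G: "\<forall>f\<in>edges G - {e}. ends G f \<inter> A = {} \<or> ends G f \<subseteq> A \<union> {x}"
    by blast
  have G: "x \<in> verts G" "s \<in> verts G" "t \<in> verts G"
    using A(1) verts_part[OF ij(2)] two_terminal_join unfolding two_terminal_def by blast+
  show ?thesis
  proof (rule toughness_le_half)
    show "finite (verts (del_edge G e))" "{x} \<subseteq> verts (del_edge G e)"
        "s \<in> verts (del_edge G e) - {x}" "t \<in> verts (del_edge G e) - {x}"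
      using A(2) G multigraph.finite_verts[OF assms(1)] by (auto simp: del_edge_def)
    show "ends (del_edge G e) f \<inter> A = {} \<or> ends (del_edge G e) f \<subseteq> A \<union> {x}"
      if "f \<in> edges (del_edge G e)" for f
      using bspec[OF edges_G, of f] that by (simp add: del_edge_def)
  qed (simp_all add: A)
qed

text \<open>The first joint is a cut vertex. For toughness above one half this rules out a series
  root.\<close>

lemma toughness_series:
  assumes "multigraph G" "sp_construction G s t (Series Ts)"
  shows "toughness G \<le> ereal (1/2)"
proof -
  obtain x A where A: "x \<in> verts G" "x \<notin> {s, t}" "s \<in> A" "t \<notin> A"
      and edges_A: "\<forall>f\<in>edges G. ends G f \<inter> A = {} \<or> ends G f \<subseteq> A \<union> {x}"
    using series_cut[OF assms(2)] by blast
  have st: "s \<in> verts G" "t \<in> verts G"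
    using two_terminal_sp[OF assms(2)] by (simp_all add: two_terminal_def)
  show ?thesis
  proof (rule toughness_le_half)
    show "finite (verts G)" "{x} \<subseteq> verts G" "s \<in> verts G - {x}" "t \<in> verts G - {x}"
      using A(1,2) st multigraph.finite_verts[OF assms(1)] by auto
    show "ends G f \<inter> A = {} \<or> ends G f \<subseteq> A \<union> {x}" if "f \<in> edges G" for f
      by (rule bspec[OF edges_A that])
  qed (simp_all add: A)
qed

text \<open>Two isolated vertices remain, and the empty set is a cutset.\<close>

lemma toughness_del_only_edge:
  assumes "multigraph G" "sp_construction G s t (Leaf e)"
  shows "toughness (del_edge G e) \<le> ereal (1/2)"
proof -
  have "s \<noteq> t" "s \<in> verts G" "t \<in> verts G"
    using two_terminal_sp[OF assms(2)] by (auto simp: two_terminal_def)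
  then show ?thesis
    using sp_LeafD[OF assms(2)] multigraph.finite_verts[OF assms(1)]
    by (intro toughness_le_half[where S = "{}" and A = "{s}" and y = s and z = t])
      (auto simp: del_edge_def)
qed

text \<open>Supplies the case distinction on the parent of an edge; the single-edge graph is the
  case without a parent.\<close>

lemma edge_parent:
  assumes "sp_construction G s t T" "e \<in> edges G"
  shows "T = Leaf e \<or> (\<exists>Ts. (Series Ts \<in> nodes T \<or> Parallel Ts \<in> nodes T) \<and> Leaf e \<in> set Ts)"
    (is "T = Leaf e \<or> ?P T")
  using assms
proof (induction rule: sp_construction.induct)
  case (series k Gs Ts xs G s t)
  obtain i where i: "i < length Gs" "e \<in> edges (Gs ! i)"
    using is_unionD(1)[OF \<open>is_union G Gs\<close> series.prems] by blast
  then have U: "Ts ! i \<in> set Ts" and "Ts ! i = Leaf e \<or> ?P (Ts ! i)"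
    using series.hyps(2,3) series.IH by simp_all
  then have "?P (Series Ts)"
    by (elim disjE) (use U in \<open>simp, metis\<close>, use U in \<open>simp, blast\<close>)
  then show ?case ..
next
  case (parallel k Gs Ts s t G)
  obtain i where i: "i < length Gs" "e \<in> edges (Gs ! i)"
    using is_unionD(1)[OF \<open>is_union G Gs\<close> parallel.prems] by blast
  then have U: "Ts ! i \<in> set Ts" and "Ts ! i = Leaf e \<or> ?P (Ts ! i)"
    using parallel.hyps(2,3) parallel.IH by simp_all
  then have "?P (Parallel Ts)"
    by (elim disjE) (use U in \<open>simp, metis\<close>, use U in \<open>simp, blast\<close>)
  then show ?case ..
qed auto

theorem theorem3p2:
  fixes G :: "('v, 'e) mgraph"
    and a b :: 'v
    and T :: "'e sptree"
    and t :: real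
  assumes "multigraph G"
    and "series_parallel G a b"
    and "sp_tree G a b T"
    and "1/2 < t" and "t < 1"
    and "toughness G = ereal t"
  shows "minimally_tough t G \<longleftrightarrow> \<not> (\<exists>e \<in> edges G. jump_edge T e)"
proof -
  have sp: "sp_construction G a b T" and alt: "alternating T"
    using assms(3) by (auto simp: sp_tree_def)
  show ?thesis
  proof
    assume min: "minimally_tough t G"
    show "\<not> (\<exists>e \<in> edges G. jump_edge T e)"
    proof
      assume "\<exists>e \<in> edges G. jump_edge T e"
      then obtain e Ts where e: "e \<in> edges G" "Parallel Ts \<in> nodes T" "Leaf e \<in> set Ts"
          "\<not> leap_edge T e"
        by (auto simp: jump_edge_def)
      have G: "multigraph G" "0 \<le> t" "t \<le> 1" "tough t G"
        using assms tough_toughness by auto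
      have "tough t (del_edge G e)"
      proof (cases T)
        \<comment> \<open>Impossible, because the toughness would be at most one half.\<close>
        case (Series Us)
        then show ?thesis
          using toughness_series[OF assms(1)] sp assms(4,6) by fastforce
      next
        case (Parallel Us)
        show ?thesis
        proof (cases "Ts = Us")
          case True
          then show ?thesis
            using tough_del_root_edge[OF G] sp e alt Parallel by metis
        next
          case False
          then obtain U where "U \<in> set Us" "Parallel Ts \<in> nodes U"
            using e(2) Parallel by auto
          then show ?thesis
            using tough_del_nested_edge[OF G] sp e(3) Parallel by metis
        qed
      qed (use e in auto)
      \<comment> \<open>Minimality demands that the toughness drop below \<open>t\<close>.\<close>
      then show False
        using toughness_ge min e(1) by (force simp: minimally_tough_def)
    qed
  next
    assume no_jump: "\<not> (\<exists>e \<in> edges G. jump_edge T e)"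
    have "toughness (del_edge G e) < ereal t" if e: "e \<in> edges G" for e
    proof -
      \<comment> \<open>An edge below a parallel node that is not a jump-edge is a
        leap-edge.\<close>
      consider "T = Leaf e" | Ts where "Series Ts \<in> nodes T" "Leaf e \<in> set Ts" | "leap_edge T e"
        using edge_parent[OF sp e] no_jump e by (auto simp: jump_edge_def)
      then have "toughness (del_edge G e) \<le> ereal (1/2)"
      proof cases
        case 1
        then show ?thesis
          using toughness_del_only_edge[OF assms(1)] sp by blast
      next
        case 2
        then show ?thesis
          by (rule toughness_del_series_edge[OF assms(1) sp])
      next
        case 3
        then show ?thesis
          by (rule toughness_del_leap_edge[OF assms(1) sp])
      qed
      also have "\<dots> < ereal t"
        using assms(4) by simp
      finally show ?thesis .
    qed
    then show "minimally_tough t G"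
      using assms(6) by (simp add: minimally_tough_def)
  qed
qed

end
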